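(* Let $X$ be a finite topological $T_0$-space. Then $S_F(X)\geq 2^{|D(X)|}$.
   Context: For a finite topological $T_0$-space $X$ and $x\in X$, $U_x$ is the intersection of all open sets containing $x$. The relation $x\leq y \iff U_x\subseteq U_y$ is a partial order on $X$, so $U_x=\{y: y\le x\}$; open sets are exactly the lower sets. A point $x\in X$ is a down beat point if $U_x\setminus\{x\}$ has a maximum. $D(X)$ denotes the set of down beat points of $X$. $\mathbb{R}_0^+$ is the set of non-negative real numbers with the usual topology. A semiflow on $X$ is a continuous map $\varphi:\mathbb{R}_0^+\times X\to X$ (product topology on the domain) such that $\varphi(0,x)=x$ for all $x\in X$ and $\varphi(s,\varphi(t,x))=\varphi(s+t,x)$ for all $x\in X$, $s,t\in\mathbb{R}_0^+$. $S_F(X)$ denotes the number of distinct semiflows on $X$ (including the trivial one, $\varphi(t,x)=x$). *)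

theory Defs
  imports "HOL-Analysis.Analysis"
begin

definition min_open :: "'a topology \<Rightarrow> 'a \<Rightarrow> 'a set" where
  "min_open X x = \<Inter>{U. openin X U \<and> x \<in> U}"

definition spec_le :: "'a topology \<Rightarrow> 'a \<Rightarrow> 'a \<Rightarrow> bool" where
  "spec_le X x y \<longleftrightarrow> min_open X x \<subseteq> min_open X y"

definition down_beat_points :: "'a topology \<Rightarrow> 'a set" where
  "down_beat_points X =
     {x \<in> topspace X. \<exists>m \<in> min_open X x - {x}. \<forall>y \<in> min_open X x - {x}. spec_le X y m}"

text \<open>A semiflow is a function on \<open>{0..} \<times> topspace X\<close>. It is encoded as a total function that is
  \<^const>\<open>undefined\<close> outside that domain (\<^const>\<open>extensional\<close>), so that distinct
  HOL functions correspond to distinct semiflows and counting them is meaningful.\<close>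

definition semiflow :: "'a topology \<Rightarrow> (real \<times> 'a \<Rightarrow> 'a) \<Rightarrow> bool" where
  "semiflow X \<phi> \<longleftrightarrow>
     \<phi> \<in> extensional ({0..} \<times> topspace X) \<and>
     continuous_map (prod_topology (top_of_set {0..}) X) X \<phi> \<and>
     (\<forall>x \<in> topspace X. \<phi> (0, x) = x) \<and>
     (\<forall>x \<in> topspace X. \<forall>s \<ge> 0. \<forall>t \<ge> 0. \<phi> (s, \<phi> (t, x)) = \<phi> (s + t, x))"

text \<open>\<^const>\<open>card\<close> of an infinite set is 0, so a lower bound on the following number is never
  obtained for free from infinitude. A finite space has only finitely many semiflows: \<open>\<phi> (t, _)\<close>
  takes values in a finite monoid of maps, which forces it to be the same idempotent map for all
  \<open>t > 0\<close>.\<close>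

definition num_semiflows :: "'a topology \<Rightarrow> nat" where
  "num_semiflows X = card {\<phi>. semiflow X \<phi>}"

end

theory Submission
  imports Defs
begin

text \<open>For a set \<open>A\<close> of down beat points every \<open>x\<close> has a largest element \<open>r x \<le> x\<close> outside \<open>A\<close>:
  descend from \<open>x\<close> along maxima of \<open>U\<^sub>y - {y}\<close> until \<open>A\<close> is left. The map \<open>r\<close> is monotone,
  idempotent, below the identity and has fixed point set \<open>X - A\<close>; staying at \<open>x\<close> at time \<open>0\<close> and
  at \<open>r x\<close> at all positive times is therefore a semiflow, and it determines \<open>A\<close>. Since the number
  of semiflows is a cardinality, their finiteness is also needed. By the pigeonhole principle
  \<open>\<phi> (u, _)\<close> has an idempotent power with an exponent independent of \<open>u\<close>, so every \<open>\<phi> (t, _)\<close> is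
  idempotent, and from this \<open>\<phi> (t, _)\<close> is independent of \<open>t > 0\<close>.\<close>

section \<open>Minimal open sets in finite T0 spaces\<close>

lemma min_open_self: "x \<in> min_open X x"
  by (auto simp: min_open_def)

lemma min_open_subset: "openin X U \<Longrightarrow> x \<in> U \<Longrightarrow> min_open X x \<subseteq> U"
  by (auto simp: min_open_def)

lemma min_open_subset_topspace: "x \<in> topspace X \<Longrightarrow> min_open X x \<subseteq> topspace X"
  by (simp add: min_open_subset)

lemma openin_min_open:
  assumes "finite (topspace X)" "x \<in> topspace X"
  shows "openin X (min_open X x)"
  unfolding min_open_def
proof (rule openin_Inter)
  show "finite {U. openin X U \<and> x \<in> U}"
    by (rule finite_subset[of _ "Pow (topspace X)"]) (use assms in \<open>auto dest: openin_subset\<close>)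
qed (use assms in auto)

lemma min_open_mono:
  assumes "finite (topspace X)" "x \<in> topspace X" "y \<in> min_open X x"
  shows "min_open X y \<subseteq> min_open X x"
  using assms by (simp add: min_open_subset openin_min_open)

lemma min_open_antisym:
  assumes "t0_space X" "x \<in> topspace X" "y \<in> topspace X"
    and "x \<in> min_open X y" "y \<in> min_open X x"
  shows "x = y"
  using assms unfolding t0_space_def min_open_def by blast

lemma openin_iff_min_open_subset:
  assumes "finite (topspace X)" "U \<subseteq> topspace X" "\<And>x. x \<in> U \<Longrightarrow> min_open X x \<subseteq> U"
  shows "openin X U"
  using assms by (subst openin_subopen) (blast intro: openin_min_open min_open_self)

section \<open>Retractions that move exactly a given set of down beat points\<close>

definition largest_outside :: "'a topology \<Rightarrow> 'a set \<Rightarrow> 'a \<Rightarrow> 'a \<Rightarrow> bool" where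
  "largest_outside X A x z \<longleftrightarrow>
     z \<in> min_open X x - A \<and> (\<forall>y \<in> min_open X x - A. y \<in> min_open X z)"

text \<open>If \<open>x\<close> lies in \<open>A\<close> and \<open>m\<close> is the maximum of
  \<open>min_open X x - {x}\<close>, then \<open>min_open X x\<close> and
  \<open>min_open X m\<close> have the same points outside \<open>A\<close>, so a solution for
  \<open>m\<close> also serves \<open>x\<close>.\<close>

lemma ex_largest_outside:
  assumes fin: "finite (topspace X)" and t0: "t0_space X" and A: "A \<subseteq> down_beat_points X"
    and x: "x \<in> topspace X"
  shows "\<exists>z. largest_outside X A x z"
  using x
proof (induction "card (min_open X x)" arbitrary: x rule: less_induct)
  case less
  show ?case
  proof (cases "x \<in> A")
    case False
    then have "largest_outside X A x x"
      by (simp add: largest_outside_def min_open_self)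
    then show ?thesis ..
  next
    case True
    with A have "x \<in> down_beat_points X" by blast
    then obtain m where "m \<in> min_open X x - {x}"
      and max: "\<And>y. y \<in> min_open X x - {x} \<Longrightarrow> min_open X y \<subseteq> min_open X m"
      unfolding down_beat_points_def spec_le_def mem_Collect_eq by metis
    then have m: "m \<in> min_open X x" "m \<noteq> x" by auto
    have mX: "m \<in> topspace X"
      using m(1) min_open_subset_topspace[OF less.prems] by blast
    have sub: "min_open X m \<subseteq> min_open X x"
      using fin less.prems m(1) by (rule min_open_mono)
    \<comment> \<open>T0 makes the descent strict, so the induction measure drops.\<close>
    have "x \<notin> min_open X m"
      using min_open_antisym[OF t0 less.prems mX] m by blast
    then have "min_open X m \<subset> min_open X x"
      using sub min_open_self[of x X] by blast
    moreover have "finite (min_open X x)"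
      using min_open_subset_topspace[OF less.prems] fin by (rule finite_subset)
    ultimately obtain z where z: "largest_outside X A m z"
      using less.hyps[OF psubset_card_mono mX] by blast
    have "y \<in> min_open X m" if "y \<in> min_open X x - A" for y
      using max[of y] that True min_open_self[of y X] by blast
    then have "largest_outside X A x z"
      using z sub by (auto simp: largest_outside_def)
    then show ?thesis ..
  qed
qed

definition retract_outside :: "'a topology \<Rightarrow> 'a set \<Rightarrow> 'a \<Rightarrow> 'a" where
  "retract_outside X A x = (SOME z. largest_outside X A x z)"

text \<open>The restricted abstraction supplies the value \<open>undefined\<close> off the domain
  that \<open>semiflow\<close> demands.\<close>

definition jump_flow :: "'a topology \<Rightarrow> ('a \<Rightarrow> 'a) \<Rightarrow> real \<times> 'a \<Rightarrow> 'a" where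
  "jump_flow X r = (\<lambda>(t, x) \<in> {0..} \<times> topspace X. if t = 0 then x else r x)"

text \<open>The delicate point is continuity at time 0. It holds because every open set containing
  \<open>x\<close> contains \<open>r x\<close> too.\<close>

lemma semiflow_jump_flow:
  assumes cont: "continuous_map X X r"
    and below: "\<And>x. x \<in> topspace X \<Longrightarrow> r x \<in> min_open X x"
    and idem: "\<And>x. x \<in> topspace X \<Longrightarrow> r (r x) = r x"
  shows "semiflow X (jump_flow X r)"
proof -
  have rX: "r x \<in> topspace X" if "x \<in> topspace X" for x
    using cont that by (auto simp: continuous_map_def)
  have "continuous_map (prod_topology (top_of_set {0..}) X) X (jump_flow X r)"
    unfolding continuous_map_def
  proof (intro conjI allI impI)
    show "jump_flow X r \<in> topspace (prod_topology (top_of_set {0..}) X) \<rightarrow> topspace X"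
      using rX by (auto simp: jump_flow_def)
    fix U assume U: "openin X U"
    let ?V = "{x \<in> topspace X. r x \<in> U}"
    have "r x \<in> U" if "x \<in> U" for x
      using that below[of x] openin_subset[OF U] min_open_subset[OF U that] by blast
    \<comment> \<open>As \<open>U\<close> lies in \<open>?V\<close>, the slices of the preimage grow
      from \<open>U\<close> at time 0 to \<open>?V\<close> at positive times, giving a union of two
      open boxes.\<close>
    then have "{p \<in> topspace (prod_topology (top_of_set {0..}) X). jump_flow X r p \<in> U}
        = ({0..} \<times> U) \<union> ({0<..} \<times> ?V)"
      using openin_subset[OF U] by (auto simp: jump_flow_def split: if_splits)
    moreover have "openin (prod_topology (top_of_set {0..}) X) ({0::real..} \<times> U)"
      using U by (auto simp: openin_prod_Times_iff)
    moreover have "openin (prod_topology (top_of_set {0..}) X) ({0::real<..} \<times> ?V)"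
      using openin_continuous_map_preimage[OF cont U]
        open_subset[of "{0::real<..}" "{0..}"]
      by (simp add: openin_prod_Times_iff subset_iff)
    ultimately show "openin (prod_topology (top_of_set {0..}) X)
        {p \<in> topspace (prod_topology (top_of_set {0..}) X). jump_flow X r p \<in> U}"
      by (simp only: openin_Un)
  qed
  then show ?thesis
    using rX idem by (auto simp: semiflow_def jump_flow_def)
qed

text \<open>The second claim is what recovers \<open>A\<close> from its flow. A point
  \<open>x\<close> outside \<open>A\<close> is itself a candidate, so \<open>x\<close> and its image
  lie below each other.\<close>

lemma semiflow_retract_outside:
  assumes fin: "finite (topspace X)" and t0: "t0_space X" and A: "A \<subseteq> down_beat_points X"
  shows "semiflow X (jump_flow X (retract_outside X A))"
    and "x \<in> topspace X \<Longrightarrow> retract_outside X A x = x \<longleftrightarrow> x \<notin> A"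
proof -
  let ?r = "retract_outside X A"
  have r: "largest_outside X A x (?r x)" if "x \<in> topspace X" for x
    unfolding retract_outside_def using ex_largest_outside[OF assms that] by (rule someI_ex)
  have below: "?r x \<in> min_open X x" and outside: "?r x \<notin> A"
    and greatest: "\<And>y. y \<in> min_open X x \<Longrightarrow> y \<notin> A \<Longrightarrow> y \<in> min_open X (?r x)"
    if "x \<in> topspace X" for x
    using r[OF that] by (auto simp: largest_outside_def)
  have rX: "?r x \<in> topspace X" if "x \<in> topspace X" for x
    using below[OF that] min_open_subset_topspace[OF that] by blast
  have fixed: "?r x = x" if "x \<in> topspace X" "x \<notin> A" for x
    by (rule min_open_antisym[OF t0 rX[OF that(1)] that(1) below[OF that(1)]
          greatest[OF that(1) min_open_self that(2)]])
  \<comment> \<open>The image of \<open>y\<close> is a candidate for \<open>x\<close> as well, hence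
    lies below the largest one.\<close>
  have mono: "?r y \<in> min_open X (?r x)" if "x \<in> topspace X" "y \<in> min_open X x" for x y
  proof -
    have yX: "y \<in> topspace X"
      using that(2) min_open_subset_topspace[OF that(1)] by blast
    then have "?r y \<in> min_open X x"
      using below[OF yX] min_open_mono[OF fin that] by blast
    then show ?thesis
      by (rule greatest[OF that(1) _ outside[OF yX]])
  qed
  have "continuous_map X X ?r"
    unfolding continuous_map_def
  proof (intro conjI allI impI)
    show "?r \<in> topspace X \<rightarrow> topspace X"
      using rX by blast
    fix U assume U: "openin X U"
    show "openin X {x \<in> topspace X. ?r x \<in> U}"
    proof (rule openin_iff_min_open_subset[OF fin])
      fix x assume "x \<in> {x \<in> topspace X. ?r x \<in> U}"
      then have x: "x \<in> topspace X" "?r x \<in> U" by auto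
      show "min_open X x \<subseteq> {x \<in> topspace X. ?r x \<in> U}"
        using mono[OF x(1)] min_open_subset[OF U x(2)] min_open_subset_topspace[OF x(1)] by blast
    qed auto
  qed
  then show "semiflow X (jump_flow X ?r)"
    using below fixed rX outside by (intro semiflow_jump_flow) auto
  show "?r x = x \<longleftrightarrow> x \<notin> A" if "x \<in> topspace X"
    using fixed[OF that] outside[OF that] by auto
qed

section \<open>Rigidity and finiteness of semiflows\<close>

lemma semiflow_mem:
  assumes "semiflow X \<phi>" "x \<in> topspace X" "0 \<le> t"
  shows "\<phi> (t, x) \<in> topspace X"
  using assms unfolding semiflow_def continuous_map_def by auto

lemma semiflow_add:
  assumes "semiflow X \<phi>" "x \<in> topspace X" "0 \<le> s" "0 \<le> t"
  shows "\<phi> (s + t, x) = \<phi> (s, \<phi> (t, x))"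
  using assms by (simp add: semiflow_def)

lemma semiflow_periodic:
  assumes sf: "semiflow X \<phi>" and x: "x \<in> topspace X" and t: "0 \<le> t" and per: "\<phi> (t, x) = x"
  shows "\<phi> (real n * t, x) = x"
proof (induction n)
  case 0
  then show ?case using sf x by (simp add: semiflow_def)
next
  case (Suc n)
  then show ?case
    using semiflow_add[OF sf x t, of "real n * t"] t per by (simp add: algebra_simps)
qed

text \<open>The orbit of \<open>x\<close> at multiples of \<open>u\<close> has a preperiod
  \<open>i\<close> and a period \<open>p\<close>, both at most \<open>n\<close>. From index
  \<open>fact n\<close> on it is periodic, and \<open>p\<close> divides \<open>fact n\<close>, so
  indices \<open>fact n\<close> and \<open>2 * fact n\<close> agree.\<close>

lemma semiflow_idem:
  assumes fin: "finite (topspace X)" and sf: "semiflow X \<phi>" and x: "x \<in> topspace X" and t: "0 < t"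
  shows "\<phi> (t, \<phi> (t, x)) = \<phi> (t, x)"
proof -
  define n where "n = card (topspace X)"
  \<comment> \<open>The step must be fixed before \<open>i\<close> and \<open>p\<close> are known;
    \<open>fact n\<close> suits all of their possible values.\<close>
  define u where "u = t / fact n"
  have u: "0 < u" "fact n * u = t"
    using t by (auto simp: u_def)
  define h where "h k = \<phi> (real k * u, x)" for k :: nat
  have hX: "h k \<in> topspace X" for k
    using semiflow_mem[OF sf x] u by (simp add: h_def)
  have shift: "h (k + l) = \<phi> (real k * u, h l)" for k l
    using semiflow_add[OF sf x, of "real k * u" "real l * u"] u by (simp add: h_def algebra_simps)
  \<comment> \<open>There are \<open>n + 1\<close> indices but at most \<open>n\<close>
    values.\<close>
  have "card (h ` {..n}) < card {..n}"
  proof -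
    have "card (h ` {..n}) \<le> n"
      unfolding n_def using fin hX by (intro card_mono) auto
    then show ?thesis by simp
  qed
  then have "\<not> inj_on h {..n}"
    by (rule pigeonhole)
  then obtain i j where ij: "i < j" "j \<le> n" "h i = h j"
    by (auto simp: inj_on_def) (metis linorder_neqE_nat)
  define p where "p = j - i"
  have p: "0 < p" "p \<le> n" "i + p = j"
    using ij by (auto simp: p_def)
  have step: "h (k + p) = h k" if "i \<le> k" for k
  proof -
    have "k + p = (k - i) + j" "k = (k - i) + i"
      using p that by auto
    then show ?thesis
      using shift[of "k - i" i] shift[of "k - i" j] ij(3) by metis
  qed
  have steps: "h (fact n + m * p) = h (fact n)" for m
  proof (induction m)
    case (Suc m)
    have "i \<le> fact n + m * p"
      using ij fact_ge_self[of n] by linarith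
    then show ?case
      using step[of "fact n + m * p"] Suc by (simp add: algebra_simps)
  qed simp
  have "p dvd fact n"
    using p by (intro dvd_fact) auto
  then obtain m where "(fact n :: nat) = m * p"
    by (metis dvd_def mult.commute)
  then have "h (fact n + fact n) = h (fact n)"
    using steps[of m] by simp
  then show ?thesis
    using shift[of "fact n" "fact n"] u by (simp add: h_def)
qed

text \<open>The point \<open>y\<close> is periodic with period \<open>s\<close>, so the flow leads
  from \<open>z\<close> back to \<open>y\<close>. Time maps commute and \<open>z\<close> is fixed at
  time \<open>c\<close>, so \<open>y\<close> is fixed at time \<open>c\<close> too.\<close>

lemma semiflow_const:
  assumes fin: "finite (topspace X)" and sf: "semiflow X \<phi>" and x: "x \<in> topspace X"
    and st: "0 < s" "s < t"
  shows "\<phi> (t, x) = \<phi> (s, x)"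
proof -
  define c where "c = t - s"
  define y where "y = \<phi> (s, x)"
  define z where "z = \<phi> (c, y)"
  have c: "0 < c" using st by (simp add: c_def)
  have yX: "y \<in> topspace X"
    using semiflow_mem[OF sf x] st by (simp add: y_def)
  have zX: "z \<in> topspace X"
    using semiflow_mem[OF sf yX] c by (simp add: z_def)
  have y: "\<phi> (s, y) = y"
    using semiflow_idem[OF fin sf x st(1)] by (simp add: y_def)
  have z: "\<phi> (c, z) = z"
    using semiflow_idem[OF fin sf yX c] by (simp add: z_def)
  obtain m :: nat where "c < real m * s"
    using reals_Archimedean3[OF st(1)] by blast
  then have d: "0 \<le> real m * s - c" by simp
  \<comment> \<open>Time \<open>c\<close> from \<open>y\<close> to \<open>z\<close> followed by
    \<open>m * s - c\<close> makes \<open>m\<close> full periods.\<close>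
  have return: "\<phi> (real m * s - c, z) = y"
    using semiflow_add[OF sf yX d, of c] c semiflow_periodic[OF sf yX _ y, of m] st
    by (simp add: z_def)
  have "z = \<phi> (c, \<phi> (real m * s - c, z))"
    using return by (simp add: z_def)
  also have "\<dots> = \<phi> (real m * s - c, \<phi> (c, z))"
    using c d by (simp flip: semiflow_add[OF sf zX])
  also have "\<dots> = y"
    using z return by simp
  finally have "z = y" .
  moreover have "\<phi> (t, x) = z"
    using semiflow_add[OF sf x, of c s] c st by (simp add: z_def y_def c_def)
  ultimately show ?thesis by (simp add: y_def)
qed

lemma semiflow_eq_jump_flow:
  assumes fin: "finite (topspace X)" and sf: "semiflow X \<phi>"
  shows "\<phi> = jump_flow X (\<lambda>x \<in> topspace X. \<phi> (1, x))"
proof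
  fix p :: "real \<times> 'a"
  obtain t x where p: "p = (t, x)" by (cases p)
  show "\<phi> p = jump_flow X (\<lambda>x \<in> topspace X. \<phi> (1, x)) p"
  proof (cases "0 \<le> t \<and> x \<in> topspace X")
    case False
    then have "p \<notin> {0..} \<times> topspace X"
      by (auto simp: p)
    moreover have "\<phi> \<in> extensional ({0..} \<times> topspace X)"
      using sf by (simp add: semiflow_def)
    ultimately have "\<phi> p = undefined"
      by (rule extensional_arb[rotated])
    then show ?thesis
      using False by (auto simp: p jump_flow_def)
  next
    case True
    have "\<phi> (t, x) = \<phi> (1, x)" if "0 < t"
      using semiflow_const[OF fin sf, of x t 1] semiflow_const[OF fin sf, of x 1 t] True that
      by (cases t "1::real" rule: linorder_cases) auto
    then show ?thesis
      using True sf unfolding semiflow_def by (cases "t = 0") (simp_all add: p jump_flow_def)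
  qed
qed

text \<open>A semiflow is determined by its time-one map, a self-map of a finite set.\<close>

lemma finite_semiflows:
  assumes fin: "finite (topspace X)"
  shows "finite {\<phi>. semiflow X \<phi>}"
proof (rule finite_subset)
  show "{\<phi>. semiflow X \<phi>} \<subseteq> jump_flow X ` (topspace X \<rightarrow>\<^sub>E topspace X)"
  proof
    fix \<phi> assume "\<phi> \<in> {\<phi>. semiflow X \<phi>}"
    then have sf: "semiflow X \<phi>" by simp
    then have "(\<lambda>x \<in> topspace X. \<phi> (1, x)) \<in> topspace X \<rightarrow>\<^sub>E topspace X"
      by (simp add: semiflow_mem)
    then show "\<phi> \<in> jump_flow X ` (topspace X \<rightarrow>\<^sub>E topspace X)"
      by (rule rev_image_eqI) (rule semiflow_eq_jump_flow[OF fin sf])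
  qed
  show "finite (jump_flow X ` (topspace X \<rightarrow>\<^sub>E topspace X))"
    using fin by (intro finite_imageI finite_PiE)
qed

theorem proposition4p2:
  fixes X :: "'a topology"
  assumes "finite (topspace X)" and "t0_space X"
  shows "num_semiflows X \<ge> 2 ^ card (down_beat_points X)"
proof -
  let ?D = "down_beat_points X"
  let ?F = "\<lambda>A. jump_flow X (retract_outside X A)"
  have D: "?D \<subseteq> topspace X"
    by (auto simp: down_beat_points_def)
  \<comment> \<open>Any positive time would do: the points moved by then are exactly those of
    \<open>A\<close>, which gives a left inverse of \<open>?F\<close>.\<close>
  have recover: "{x \<in> topspace X. ?F A (1, x) \<noteq> x} = A" if "A \<in> Pow ?D" for A
  proof -
    have "A \<subseteq> ?D" using that by simp
    then have "?F A (1, x) = x \<longleftrightarrow> x \<notin> A" if "x \<in> topspace X" for x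
      using semiflow_retract_outside(2)[OF assms _ that] that by (simp add: jump_flow_def)
    then show ?thesis
      using \<open>A \<subseteq> ?D\<close> D by blast
  qed
  have "inj_on ?F (Pow ?D)"
    by (rule inj_on_inverseI[where g = "\<lambda>\<phi>. {x \<in> topspace X. \<phi> (1, x) \<noteq> x}"]) (rule recover)
  then have "card (Pow ?D) \<le> card {\<phi>. semiflow X \<phi>}"
    using semiflow_retract_outside(1)[OF assms] finite_semiflows[OF assms(1)]
    by (intro card_inj_on_le) auto
  then show ?thesis
    using finite_subset[OF D assms(1)] by (simp add: num_semiflows_def card_Pow)
qed

end
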